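(* Assume that the semi-discrete scheme $$\frac{d}{dt}v_j(t)+\frac{f_{j+\frac12}-f_{j-\frac12}}{\delta x}=0,\qquad j\in\mathbb{Z},$$ is an entropy stable approximation of $\partial_tv+\partial_xf(v)=0$: there exists an entropy flux $\mathcal{G}_{0,j+\frac12}$ consistent with $G_0$ such that $$\frac{d}{dt}U(v_j(t))+\frac{\mathcal{G}_{0,j+\frac12}-\mathcal{G}_{0,j-\frac12}}{\delta x}\le0 .$$ Let $\delta t>0$, $\lambda_1=\delta t/\delta x$, $\lambda_2=\delta t/\delta x^2$. Then the backward Euler scheme $$v_j^{n+1}-v_j^n+\lambda_1\big(f_{j+\frac12}^{n+1}-f_{j-\frac12}^{n+1}\big)=\lambda_2\Big(B(\rho_{j+\frac12}^{n+1})(z_{j+1}^{n+1}-z_j^{n+1})-B(\rho_{j-\frac12}^{n+1})(z_j^{n+1}-z_{j-1}^{n+1})\Big)$$ is entropy stable. Precisely, for any of its solutions (with positive densities), setting $$\mathcal{G}_{j+\frac12}^n=\mathcal{G}_{0,j+\frac12}(v^{n+1})-\mu_{j+\frac12}^{n+1}\,\frac{u_j^{n+1}w_{j+1}^{n+1}-u_{j+1}^{n+1}w_j^{n+1}}{\delta x},$$ one has $$U(v_j^{n+1})-U(v_j^n)+\frac{\delta t}{\delta x}\big(\mathcal{G}_{j+\frac12}^n-\mathcal{G}_{j-\frac12}^n\big)\le0,\qquad\forall j\in\mathbb{Z},\ \forall n\in\mathbb{N}.$$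
   Context: Let $P$ be a smooth pressure with $P'(\rho)>0$ for $\rho>0$, $F$ a smooth function with $\rho F'(\rho)-F(\rho)=P(\rho)$, $\kappa(\rho)>0$ a smooth capillary coefficient, and $\mu(\rho)=\rho^{3/2}\sqrt{\kappa(\rho)}$. The extended Euler–Korteweg system is $$\partial_tv+\partial_xf(v)=\partial_x\big(B(\rho)\partial_xz\big),\qquad v=(\rho,\rho u,\rho w)^T,\quad\rho>0,$$ with $$f(v)=(\rho u,\ \rho u^2+P(\rho),\ \rho uw)^T,\qquad B(\rho)=\begin{pmatrix}0&0&0\\0&0&\mu(\rho)\\0&-\mu(\rho)&0\end{pmatrix},$$ $$U(v)=\rho\frac{u^2+w^2}{2}+F(\rho),\qquad z=\nabla_vU(v)$$ (the second and third components of $z$ are $u$ and $w$). The first order part ($B=0$) has the entropy–entropy flux pair $(U,G_0)$ with $G_0(v)=u(U(v)+P(\rho))$. Discrete notation: $\delta x>0$; $v_j=(\rho_j,\rho_ju_j,\rho_jw_j)^T$ with $\rho_j>0$; $z_j=\nabla_vU(v_j)$. The numerical flux $f_{j+\frac12}$ is a given continuous function of finitely many neighbouring states. The interface value $\rho_{j+\frac12}>0$ is a given function of neighbouring densities, equal to $\rho$ when these all equal $\rho$, and $\mu_{j+\frac12}=\mu(\rho_{j+\frac12})$. A superscript $n$ (resp. $n+1$) means evaluation at the discrete states $v^n$ (resp. $v^{n+1}$). In the semi-discrete entropy inequality, $\frac{d}{dt}U(v_j)=\nabla_vU(v_j)^T\frac{dv_j}{dt}$ with $\frac{dv_j}{dt}$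 given by the scheme. The inequality is required for all $j$ and all states $(v_k)_k$ with $\rho_k>0$. Consistency of $\mathcal{G}_{0,j+\frac12}$ with $G_0$ means that it is a continuous function of finitely many neighbouring states which equals $G_0(v)$ when all of them equal $v$. *)

theory Defs
  imports "HOL-Analysis.Analysis"
begin

definition smooth_pos :: "(real \<Rightarrow> real) \<Rightarrow> bool" where
  "smooth_pos g \<longleftrightarrow> (\<forall>k. \<forall>x>0. (deriv ^^ k) g differentiable (at x))"

definition gradient :: "('a::real_inner \<Rightarrow> real) \<Rightarrow> 'a \<Rightarrow> 'a" where
  "gradient g x = (THE D. GDERIV g x :> D)"

lemma gradient_eqI:
  assumes "GDERIV g x :> D"
  shows "gradient g x = D"
  unfolding gradient_def
proof (rule the_equality[where P = "\<lambda>D. GDERIV g x :> D", OF assms])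
  fix E assume "GDERIV g x :> E"
  then have "(\<lambda>h. h \<bullet> E) = (\<lambda>h. h \<bullet> D)"
    using assms unfolding gderiv_def by (rule has_derivative_unique)
  then show "E = D"
    by (metis inner_commute vector_eq_rdot)
qed

text \<open>A state is the vector of conservative variables \<open>v = (\<rho>, \<rho> u, \<rho> w)\<close>.\<close>

abbreviation dens :: "real^3 \<Rightarrow> real" where "dens v \<equiv> v $ 1"

definition vel_u :: "real^3 \<Rightarrow> real" where "vel_u v = v $ 2 / dens v"

definition vel_w :: "real^3 \<Rightarrow> real" where "vel_w v = v $ 3 / dens v"

definition states :: "(real^3) set" where "states = {v. dens v > 0}"

definition energy :: "(real \<Rightarrow> real) \<Rightarrow> real^3 \<Rightarrow> real" where
  "energy F v = dens v * (((vel_u v)\<^sup>2 + (vel_w v)\<^sup>2) / 2) + F (dens v)"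

definition entropy_var :: "(real \<Rightarrow> real) \<Rightarrow> real^3 \<Rightarrow> real^3" where
  "entropy_var F v = gradient (energy F) v"

definition entropy_flux :: "(real \<Rightarrow> real) \<Rightarrow> (real \<Rightarrow> real) \<Rightarrow> real^3 \<Rightarrow> real" where
  "entropy_flux P F v = vel_u v * (energy F v + P (dens v))"

definition mu :: "(real \<Rightarrow> real) \<Rightarrow> real \<Rightarrow> real" where
  "mu \<kappa> r = r powr (3/2) * sqrt (\<kappa> r)"

definition Bmat :: "(real \<Rightarrow> real) \<Rightarrow> real \<Rightarrow> real^3^3" where
  "Bmat \<kappa> r = vector [vector [0, 0,        0     ],
                      vector [0, 0,        mu \<kappa> r],
                      vector [0, - mu \<kappa> r, 0     ]]"

text \<open>
  An interface quantity \<open>\<Phi>\<^bsub>j+1/2\<^esub>\<close> is encoded as \<open>\<Phi> j x\<close>, where \<open>x\<close> is the whole grid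
  function; it may only read the entries \<open>x (j + k)\<close> for \<open>k\<close> in a finite set \<open>K\<close> of offsets
  that does not depend on \<open>j\<close>.
\<close>

definition stencil_fun :: "'a set \<Rightarrow> (int \<Rightarrow> (int \<Rightarrow> 'a) \<Rightarrow> 'b) \<Rightarrow> bool" where
  "stencil_fun S \<Phi> \<longleftrightarrow>
     (\<exists>K. finite K \<and>
       (\<forall>j x y. range x \<subseteq> S \<longrightarrow> range y \<subseteq> S \<longrightarrow> (\<forall>k\<in>K. x (j + k) = y (j + k))
          \<longrightarrow> \<Phi> j x = \<Phi> j y))"

text \<open>
  Grid functions carry the product topology, so for a \<open>\<Phi> j\<close> reading only finitely many entries
  this is joint continuity in these entries.
\<close>

definition cont_stencil_fun ::
  "'a::topological_space set \<Rightarrow> (int \<Rightarrow> (int \<Rightarrow> 'a) \<Rightarrow> 'b::topological_space) \<Rightarrow> bool" where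
  "cont_stencil_fun S \<Phi> \<longleftrightarrow>
     stencil_fun S \<Phi> \<and> (\<forall>j. continuous_on {x. range x \<subseteq> S} (\<Phi> j))"

definition consistent_with :: "'a set \<Rightarrow> (int \<Rightarrow> (int \<Rightarrow> 'a) \<Rightarrow> 'b) \<Rightarrow> ('a \<Rightarrow> 'b) \<Rightarrow> bool" where
  "consistent_with S \<Phi> g \<longleftrightarrow> (\<forall>j. \<forall>a\<in>S. \<Phi> j (\<lambda>_. a) = g a)"

definition semi_discrete_rhs ::
  "real \<Rightarrow> (int \<Rightarrow> (int \<Rightarrow> real^3) \<Rightarrow> real^3) \<Rightarrow> (int \<Rightarrow> real^3) \<Rightarrow> int \<Rightarrow> real^3" where
  "semi_discrete_rhs dx f v j = - ((1 / dx) *\<^sub>R (f j v - f (j - 1) v))"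

text \<open>
  \<open>G0\<close> is an entropy flux making the semi-discrete first order scheme entropy stable. The time
  derivative of \<open>U(v\<^sub>j)\<close> along the scheme is expressed by the chain rule, so that the inequality
  is a condition on all admissible grid functions.
\<close>

definition semi_discrete_entropy_flux ::
  "(real \<Rightarrow> real) \<Rightarrow> (real \<Rightarrow> real) \<Rightarrow> real \<Rightarrow> (int \<Rightarrow> (int \<Rightarrow> real^3) \<Rightarrow> real^3) \<Rightarrow>
   (int \<Rightarrow> (int \<Rightarrow> real^3) \<Rightarrow> real) \<Rightarrow> bool" where
  "semi_discrete_entropy_flux P F dx f G0 \<longleftrightarrow>
     cont_stencil_fun states G0 \<and>
     consistent_with states G0 (entropy_flux P F) \<and>
     (\<forall>v j. range v \<subseteq> states \<longrightarrow>
        gradient (energy F) (v j) \<bullet> semi_discrete_rhs dx f v j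
          + (G0 j v - G0 (j - 1) v) / dx \<le> 0)"

definition rho_half :: "(int \<Rightarrow> (int \<Rightarrow> real) \<Rightarrow> real) \<Rightarrow> int \<Rightarrow> (int \<Rightarrow> real^3) \<Rightarrow> real" where
  "rho_half R j v = R j (\<lambda>k. dens (v k))"

definition capillary_flux ::
  "(real \<Rightarrow> real) \<Rightarrow> (real \<Rightarrow> real) \<Rightarrow> (int \<Rightarrow> (int \<Rightarrow> real) \<Rightarrow> real) \<Rightarrow>
   int \<Rightarrow> (int \<Rightarrow> real^3) \<Rightarrow> real^3" where
  "capillary_flux F \<kappa> R j v =
     Bmat \<kappa> (rho_half R j v) *v (entropy_var F (v (j + 1)) - entropy_var F (v j))"

definition backward_euler_solution ::
  "(real \<Rightarrow> real) \<Rightarrow> (real \<Rightarrow> real) \<Rightarrow> (int \<Rightarrow> (int \<Rightarrow> real) \<Rightarrow> real) \<Rightarrow>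
   (int \<Rightarrow> (int \<Rightarrow> real^3) \<Rightarrow> real^3) \<Rightarrow> real \<Rightarrow> real \<Rightarrow> (nat \<Rightarrow> int \<Rightarrow> real^3) \<Rightarrow> bool" where
  "backward_euler_solution F \<kappa> R f dx dt v \<longleftrightarrow>
     (\<forall>n j. v (n + 1) j - v n j
              + (dt / dx) *\<^sub>R (f j (v (n + 1)) - f (j - 1) (v (n + 1)))
            = (dt / dx\<^sup>2) *\<^sub>R (capillary_flux F \<kappa> R j (v (n + 1))
                            - capillary_flux F \<kappa> R (j - 1) (v (n + 1))))"

definition discrete_entropy_flux ::
  "(real \<Rightarrow> real) \<Rightarrow> (int \<Rightarrow> (int \<Rightarrow> real) \<Rightarrow> real) \<Rightarrow> (int \<Rightarrow> (int \<Rightarrow> real^3) \<Rightarrow> real) \<Rightarrow>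
   real \<Rightarrow> (nat \<Rightarrow> int \<Rightarrow> real^3) \<Rightarrow> nat \<Rightarrow> int \<Rightarrow> real" where
  "discrete_entropy_flux \<kappa> R G0 dx v n j =
     G0 j (v (n + 1))
       - mu \<kappa> (rho_half R j (v (n + 1)))
         * ((vel_u (v (n + 1) j) * vel_w (v (n + 1) (j + 1))
              - vel_u (v (n + 1) (j + 1)) * vel_w (v (n + 1) j)) / dx)"

end

theory Submission
  imports Defs
begin

text \<open>
  The relation \<open>\<rho> F' - F = P\<close> gives \<open>\<rho> F'' = P' > 0\<close>, so the energy \<open>U\<close> is convex and
  \<open>U(v\<^sup>n\<^sup>+\<^sup>1) - U(v\<^sup>n) \<le> z\<^sup>n\<^sup>+\<^sup>1 \<bullet> (v\<^sup>n\<^sup>+\<^sup>1 - v\<^sup>n)\<close>. Inserting the implicit scheme, the first order flux is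
  controlled by the semi-discrete entropy inequality at \<open>v\<^sup>n\<^sup>+\<^sup>1\<close>, while skew-symmetry of \<open>B\<close>
  (\<open>z \<bullet> B z = 0\<close>) makes the capillary terms telescope exactly.
\<close>

text \<open>The gradient is taken in the conservative variables, so the kinetic part is
  \<open>m\<^sup>2 / (2 \<rho>)\<close> with the momentum \<open>m\<close> independent of the
  density. Hence its density derivative is minus half the squared velocity.\<close>

lemma energy_gderiv:
  assumes "F differentiable (at (dens a))" and "dens a > 0"
  shows "GDERIV (energy F) a :>
    vector [deriv F (dens a) - ((vel_u a)\<^sup>2 + (vel_w a)\<^sup>2) / 2, vel_u a, vel_w a]"
proof -
  have "(F has_real_derivative deriv F (dens a)) (at (dens a))"
    using assms(1) by (simp add: DERIV_deriv_iff_real_differentiable)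
  then have F: "((\<lambda>v. F (dens v)) has_derivative (\<lambda>h. deriv F (dens a) * h $ 1)) (at a)"
    by (intro has_derivative_compose[OF bounded_linear.has_derivative[OF bounded_linear_vec_nth]])
      (auto simp: has_field_derivative_def)
  have c: "((\<lambda>v. v $ i) has_derivative (\<lambda>h. h $ i)) (at a)" for i :: 3
    by (rule bounded_linear_imp_has_derivative[OF bounded_linear_vec_nth])
  \<comment> \<open>The quotient rule in the form \<open>du = (dm - u d\<rho>) / \<rho>\<close>,
    used for both velocities.\<close>
  have q: "((\<lambda>v. v $ i / dens v) has_derivative (\<lambda>h. (h $ i - a $ i / dens a * h $ 1) / dens a)) (at a)"
    for i :: 3
    by (rule has_derivative_eq_rhs[OF has_derivative_divide[OF c c]])
      (use assms(2) in \<open>simp_all add: fun_eq_iff field_simps\<close>)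
  show ?thesis
    unfolding gderiv_def energy_def vel_u_def vel_w_def
    by (rule has_derivative_eq_rhs[OF has_derivative_add[OF has_derivative_mult[OF c
          bounded_linear.has_derivative[OF bounded_linear_divide
            has_derivative_add[OF has_derivative_power[OF q] has_derivative_power[OF q]]]] F]])
      (use assms(2) in \<open>simp add: inner_vec_def sum_3 fun_eq_iff field_simps power2_eq_square\<close>)
qed

lemma entropy_var_eq:
  assumes "F differentiable (at (dens a))" and "dens a > 0"
  shows "entropy_var F a =
    vector [deriv F (dens a) - ((vel_u a)\<^sup>2 + (vel_w a)\<^sup>2) / 2, vel_u a, vel_w a]"
  unfolding entropy_var_def by (rule gradient_eqI[OF energy_gderiv[OF assms]])

lemma above_tangent_of_pressure:
  fixes P F :: "real \<Rightarrow> real"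
  assumes P_incr: "\<And>r. r > 0 \<Longrightarrow> deriv P r > 0"
    and F_diff: "\<And>r. r > 0 \<Longrightarrow> F differentiable (at r)"
    and F_diff2: "\<And>r. r > 0 \<Longrightarrow> deriv F differentiable (at r)"
    and F_P: "\<And>r. r > 0 \<Longrightarrow> r * deriv F r - F r = P r"
    and "r > 0" "s > 0"
  shows "F s + deriv F s * (r - s) \<le> F r"
proof -
  have F': "(F has_real_derivative deriv F x) (at x)" if "x > 0" for x
    using F_diff[OF that] by (simp add: DERIV_deriv_iff_real_differentiable)
  have F'': "(deriv F has_real_derivative deriv P x / x) (at x)" if x: "x > 0" for x
  proof -
    have D: "(deriv F has_real_derivative deriv (deriv F) x) (at x)"
      using F_diff2[OF x] by (simp add: DERIV_deriv_iff_real_differentiable)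
    have "((\<lambda>y. y * deriv F y - F y) has_real_derivative x * deriv (deriv F) x) (at x)"
      by (rule derivative_eq_intros D F'[OF x] refl | simp)+
    \<comment> \<open>\<open>F_P\<close> is known on positive densities only, so the derivative
      passes to \<open>P\<close> through the open half-line around \<open>x\<close>.\<close>
    then have "(P has_real_derivative x * deriv (deriv F) x) (at x)"
      by (rule has_field_derivative_transform_within_open[of _ _ _ "{0<..}"])
        (use x F_P in auto)
    then have "deriv P x = x * deriv (deriv F) x"
      by (rule DERIV_imp_deriv)
    with D x show ?thesis by simp
  qed
  have "convex_on {0<..} F"
    by (rule f''_ge0_imp_convex[of _ _ "deriv F" "\<lambda>x. deriv P x / x"])
      (use F' F'' P_incr in \<open>auto intro: less_imp_le\<close>)
  from convex_on_imp_above_tangent[OF this, of s r "deriv F s"]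
  show ?thesis
    using F'[OF \<open>s > 0\<close>] \<open>r > 0\<close> \<open>s > 0\<close>
    by (auto simp: interior_open algebra_simps intro: has_field_derivative_at_within)
qed

lemma energy_above_tangent:
  assumes P_incr: "\<And>r. r > 0 \<Longrightarrow> deriv P r > 0"
    and F_smooth: "smooth_pos F"
    and F_P: "\<And>r. r > 0 \<Longrightarrow> r * deriv F r - F r = P r"
    and a: "dens a > 0" and b: "dens b > 0"
  shows "energy F a + entropy_var F a \<bullet> (b - a) \<le> energy F b"
proof -
  have F_diff: "F differentiable (at r)" "deriv F differentiable (at r)" if "r > 0" for r
    using F_smooth that unfolding smooth_pos_def
    by (auto dest: spec[of _ 0] spec[of _ "Suc 0"])
  have F: "F (dens a) + deriv F (dens a) * (dens b - dens a) \<le> F (dens b)"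
    by (rule above_tangent_of_pressure[of P]) (use P_incr F_diff F_P a b in auto)
  have m: "a $ 2 = dens a * vel_u a" "a $ 3 = dens a * vel_w a"
          "b $ 2 = dens b * vel_u b" "b $ 3 = dens b * vel_w b"
    using a b by (auto simp: vel_u_def vel_w_def)
  have "energy F b - energy F a - entropy_var F a \<bullet> (b - a)
    = (F (dens b) - F (dens a) - deriv F (dens a) * (dens b - dens a))
      + dens b * ((vel_u b - vel_u a)\<^sup>2 + (vel_w b - vel_w a)\<^sup>2) / 2"
    by (simp add: entropy_var_eq[OF F_diff(1)[OF a] a] energy_def inner_vec_def sum_3 m)
      (simp add: field_simps power2_eq_square)
  moreover have "dens b * ((vel_u b - vel_u a)\<^sup>2 + (vel_w b - vel_w a)\<^sup>2) / 2 \<ge> 0"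
    using b by simp
  ultimately show ?thesis using F by linarith
qed

text \<open>The form is a planar cross product of the velocity components, hence
  alternating.\<close>

lemma inner_Bmat:
  "x \<bullet> (Bmat \<kappa> r *v y) = mu \<kappa> r * (x $ 2 * y $ 3 - x $ 3 * y $ 2)"
  by (simp add: Bmat_def inner_vec_def sum_3 matrix_vector_mult_def algebra_simps)

text \<open>The two values agree because their difference pairs the jump of the entropy variables
  with its own image under a skew matrix. So the cells on either side of an interface see the same
  capillary flux.\<close>

lemma
  assumes F_diff: "\<And>r. r > 0 \<Longrightarrow> F differentiable (at r)"
    and pos: "dens (V j) > 0" "dens (V (j + 1)) > 0"
  shows inner_capillary_flux_left:
      "entropy_var F (V j) \<bullet> capillary_flux F \<kappa> R j V = mu \<kappa> (rho_half R j V)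
        * (vel_u (V j) * vel_w (V (j + 1)) - vel_u (V (j + 1)) * vel_w (V j))"
    and inner_capillary_flux_right:
      "entropy_var F (V (j + 1)) \<bullet> capillary_flux F \<kappa> R j V = mu \<kappa> (rho_half R j V)
        * (vel_u (V j) * vel_w (V (j + 1)) - vel_u (V (j + 1)) * vel_w (V j))"
  by (simp_all add: capillary_flux_def inner_Bmat entropy_var_eq F_diff pos)
    (simp_all add: algebra_simps)

theorem proposition3p2:
  fixes P F \<kappa> :: "real \<Rightarrow> real"
    and f :: "int \<Rightarrow> (int \<Rightarrow> real^3) \<Rightarrow> real^3"
    and G0 :: "int \<Rightarrow> (int \<Rightarrow> real^3) \<Rightarrow> real"
    and R :: "int \<Rightarrow> (int \<Rightarrow> real) \<Rightarrow> real"
    and \<delta>x \<delta>t :: real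
    and v :: "nat \<Rightarrow> int \<Rightarrow> real^3"
  assumes P_smooth: "smooth_pos P"
    and P_increasing: "\<And>\<rho>. \<rho> > 0 \<Longrightarrow> deriv P \<rho> > 0"
    and F_smooth: "smooth_pos F"
    and F_P: "\<And>\<rho>. \<rho> > 0 \<Longrightarrow> \<rho> * deriv F \<rho> - F \<rho> = P \<rho>"
    and kappa_smooth: "smooth_pos \<kappa>"
    and kappa_pos: "\<And>\<rho>. \<rho> > 0 \<Longrightarrow> \<kappa> \<rho> > 0"
    and f_flux: "cont_stencil_fun states f"
    and R_stencil: "stencil_fun {0<..} R"
    and R_pos: "\<And>j r. range r \<subseteq> {0<..} \<Longrightarrow> R j r > 0"
    and R_consistent: "consistent_with {0<..} R (\<lambda>\<rho>. \<rho>)"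
    and dx_pos: "\<delta>x > 0"
    and dt_pos: "\<delta>t > 0"
    and first_order_entropy_stable: "semi_discrete_entropy_flux P F \<delta>x f G0"
    and solution_pos: "\<And>n. range (v n) \<subseteq> states"
    and solution: "backward_euler_solution F \<kappa> R f \<delta>x \<delta>t v"
  shows "\<forall>j n. energy F (v (n + 1) j) - energy F (v n j)
           + \<delta>t / \<delta>x * (discrete_entropy_flux \<kappa> R G0 \<delta>x v n j
                        - discrete_entropy_flux \<kappa> R G0 \<delta>x v n (j - 1)) \<le> 0"
proof (intro allI)
  fix j n
  let ?V = "v (n + 1)"
  let ?z = "entropy_var F (?V j)"
  let ?C = "\<lambda>i. capillary_flux F \<kappa> R i ?V"
  let ?H = "\<lambda>i. mu \<kappa> (rho_half R i ?V)
    * (vel_u (?V i) * vel_w (?V (i + 1)) - vel_u (?V (i + 1)) * vel_w (?V i))"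
  have pos: "dens (v m i) > 0" for m i
    using solution_pos[of m] by (auto simp: states_def image_subset_iff)
  have F_diff: "\<And>\<rho>. \<rho> > 0 \<Longrightarrow> F differentiable (at \<rho>)"
    using F_smooth by (auto simp: smooth_pos_def dest: spec[of _ 0])
  have "?z = gradient (energy F) (?V j)"
    by (simp add: entropy_var_def)
  \<comment> \<open>The semi-discrete inequality constrains every admissible grid function, so it
    applies to the new time level without any continuous evolution.\<close>
  then have stable: "?z \<bullet> semi_discrete_rhs \<delta>x f ?V j + (G0 j ?V - G0 (j - 1) ?V) / \<delta>x \<le> 0"
    using first_order_entropy_stable solution_pos by (simp add: semi_discrete_entropy_flux_def)
  \<comment> \<open>Cell \<open>j\<close> lies to the left of interface \<open>j\<close> and to the
    right of interface \<open>j - 1\<close>.\<close>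
  have cap: "?z \<bullet> (?C j - ?C (j - 1)) = ?H j - ?H (j - 1)"
    using inner_capillary_flux_left[where V = ?V and j = j, OF F_diff pos pos]
      inner_capillary_flux_right[where V = ?V and j = "j - 1", OF F_diff pos pos]
    by (simp add: inner_diff_right)
  have step: "?V j - v n j = \<delta>t *\<^sub>R semi_discrete_rhs \<delta>x f ?V j
      + (\<delta>t / \<delta>x\<^sup>2) *\<^sub>R (?C j - ?C (j - 1))"
  proof -
    have "?V j - v n j + (\<delta>t / \<delta>x) *\<^sub>R (f j ?V - f (j - 1) ?V)
        = (\<delta>t / \<delta>x\<^sup>2) *\<^sub>R (?C j - ?C (j - 1))"
      using solution unfolding backward_euler_solution_def by blast
    moreover have "\<delta>t *\<^sub>R semi_discrete_rhs \<delta>x f ?V j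
        = - ((\<delta>t / \<delta>x) *\<^sub>R (f j ?V - f (j - 1) ?V))"
      by (simp add: semi_discrete_rhs_def)
    ultimately show ?thesis
      by (simp add: eq_diff_eq)
  qed
  \<comment> \<open>The tangent is taken at the new state and evaluated at the old one, which yields
    an upper bound involving the implicit entropy variable.\<close>
  have "energy F (?V j) - energy F (v n j) \<le> ?z \<bullet> (?V j - v n j)"
    using energy_above_tangent[where a = "?V j" and b = "v n j", OF P_increasing F_smooth F_P pos pos]
    by (simp add: inner_diff_right)
  also have "\<dots> = \<delta>t * (?z \<bullet> semi_discrete_rhs \<delta>x f ?V j) + \<delta>t / \<delta>x\<^sup>2 * (?H j - ?H (j - 1))"
    by (simp only: step inner_add_right inner_scaleR_right cap)
  also have "\<dots> \<le> \<delta>t * - ((G0 j ?V - G0 (j - 1) ?V) / \<delta>x) + \<delta>t / \<delta>x\<^sup>2 * (?H j - ?H (j - 1))"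
    using stable dt_pos by (intro add_right_mono mult_left_mono) auto
  \<comment> \<open>One factor \<open>1 / \<delta>x\<close> of the capillary term goes into the
    discrete flux, where \<open>?H\<close> enters with a minus sign.\<close>
  also have "\<dots> = - (\<delta>t / \<delta>x * (discrete_entropy_flux \<kappa> R G0 \<delta>x v n j
                        - discrete_entropy_flux \<kappa> R G0 \<delta>x v n (j - 1)))"
    using dx_pos by (simp add: discrete_entropy_flux_def field_simps power2_eq_square)
  finally show "energy F (v (n + 1) j) - energy F (v n j)
           + \<delta>t / \<delta>x * (discrete_entropy_flux \<kappa> R G0 \<delta>x v n j
                        - discrete_entropy_flux \<kappa> R G0 \<delta>x v n (j - 1)) \<le> 0"
    by simp
qed

end
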